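(* Let $A_n$ be the number of ways to tile an $n$-board using squares and $(1,1)$-fences, for $n\ge0$, and set $A_n=0$ for $n<0$. Then for all integers $n\ge0$, \[ A_n=\delta_{n,0}+A_{n-1}+A_{n-3}+A_{n-4}. \]
   Context: An $n$-board is a $1\times n$ row of $n$ unit cells. A square is a $1\times1$ tile. A $(1,1)$-fence is a tile consisting of two $1\times1$ posts separated by a one-cell gap; placed on a board its posts occupy cells $i$ and $i+2$, and the gap cell $i+1$ must be covered by another tile. A tiling covers every cell exactly once; the $0$-board has exactly one (empty) tiling, so $A_0=1$. $\delta_{i,j}$ is $1$ if $i=j$ and $0$ otherwise. *)

theory Defs
  imports Main
begin

text \<open>
  The cells of the n-board are numbered 1, ..., n from left to right.  A value of type
  \<open>tile\<close> is a tile together with its position: \<open>Square i\<close> lies on cell i, and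
  \<open>Fence i\<close> is the (1,1)-fence whose left post lies on cell i.
\<close>

datatype tile = Square nat | Fence nat

primrec cells :: "tile \<Rightarrow> nat set" where
  "cells (Square i) = {i}"
| "cells (Fence i) = {i, i + 2}"

definition board :: "nat \<Rightarrow> nat set" where
  "board n = {1..n}"

text \<open>
  The gap cell of a fence is not among its cells.  It lies on the board
  whenever both posts do, so the second condition forces another tile to cover it.
\<close>

definition is_tiling :: "nat \<Rightarrow> tile set \<Rightarrow> bool" where
  "is_tiling n T \<longleftrightarrow>
     (\<forall>t\<in>T. cells t \<subseteq> board n) \<and> (\<forall>c\<in>board n. \<exists>!t. t \<in> T \<and> c \<in> cells t)"

definition A :: "int \<Rightarrow> nat" where
  "A n = (if n < 0 then 0 else card {T. is_tiling (nat n) T})"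

text \<open>There are only finitely many tilings, so \<open>card\<close> is a genuine count.\<close>

lemma finite_tilings: "finite {T. is_tiling n T}"
proof (rule finite_subset)
  show "{T. is_tiling n T} \<subseteq> Pow (Square ` {1..n} \<union> Fence ` {1..n})"
  proof (intro subsetI PowI)
    fix T t assume "T \<in> {T. is_tiling n T}" "t \<in> T"
    then have "cells t \<subseteq> {1..n}" by (simp add: is_tiling_def board_def)
    then show "t \<in> Square ` {1..n} \<union> Fence ` {1..n}" by (cases t) auto
  qed
qed simp

lemma A_0: "A 0 = 1"
proof -
  have "{T. is_tiling 0 T} = {{}}"
  proof (intro set_eqI)
    fix T
    have "cells t \<noteq> {}" for t by (cases t) auto
    then show "T \<in> {T. is_tiling 0 T} \<longleftrightarrow> T \<in> {{}}"
      by (auto simp: is_tiling_def board_def)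
  qed
  then show ?thesis by (simp add: A_def)
qed

end

theory Submission
  imports Defs "HOL-Library.Disjoint_Sets"
begin

text \<open>
  A tiling of a board of positive length ends in exactly one of three ways: with a square; with
  a fence whose gap is filled by a square; or with a fence whose gap is filled by the right post
  of another fence, in which case the two fences interlock and occupy the last four cells.
  Removing this final block leaves a tiling of a board that is shorter by one, three or four
  cells, respectively.
\<close>

text \<open>Stated for an arbitrary set of cells, so that a final block, the cells before it and the
  whole board all fall under one notion. Covering together with pairwise disjointness is easy to
  follow through unions and differences of tile sets.\<close>

definition tiles_region :: "nat set \<Rightarrow> tile set \<Rightarrow> bool" where
  "tiles_region S T \<longleftrightarrow> \<Union> (cells ` T) = S \<and> disjoint_family_on cells T"

lemma cells_nonempty: "cells t \<noteq> {}"
  by (cases t) auto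

lemma is_tiling_unique:
  assumes "is_tiling n T" "s \<in> T" "t \<in> T" "c \<in> cells s" "c \<in> cells t"
  shows "s = t"
proof -
  have "c \<in> board n"
    using assms unfolding is_tiling_def by blast
  then have "\<exists>!t. t \<in> T \<and> c \<in> cells t"
    using assms(1) unfolding is_tiling_def by blast
  with assms(2-5) show ?thesis by auto
qed

lemma is_tiling_iff_tiles_region: "is_tiling n T \<longleftrightarrow> tiles_region (board n) T"
proof
  assume T: "is_tiling n T"
  then have sub: "\<forall>t\<in>T. cells t \<subseteq> board n"
    unfolding is_tiling_def by (rule conjunct1)
  from T have cov: "\<forall>c\<in>board n. \<exists>!t. t \<in> T \<and> c \<in> cells t"
    unfolding is_tiling_def by (rule conjunct2)
  have "\<Union> (cells ` T) = board n"
  proof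
    show "\<Union> (cells ` T) \<subseteq> board n" using sub by blast
    show "board n \<subseteq> \<Union> (cells ` T)"
    proof
      fix c assume "c \<in> board n"
      with cov have "\<exists>t. t \<in> T \<and> c \<in> cells t" by (meson ex1_implies_ex)
      then show "c \<in> \<Union> (cells ` T)" by blast
    qed
  qed
  moreover have "disjoint_family_on cells T"
    unfolding disjoint_family_on_def
  proof (intro ballI impI)
    fix s t assume "s \<in> T" "t \<in> T" "s \<noteq> t"
    with is_tiling_unique[OF T] show "cells s \<inter> cells t = {}"
      by blast
  qed
  ultimately show "tiles_region (board n) T"
    by (simp add: tiles_region_def)
next
  assume "tiles_region (board n) T"
  then have cover: "\<Union> (cells ` T) = board n" and disj: "disjoint_family_on cells T"
    by (auto simp: tiles_region_def)
  have "\<exists>!t. t \<in> T \<and> c \<in> cells t" if c: "c \<in> board n" for c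
  proof -
    from c cover obtain t where "t \<in> T" "c \<in> cells t" by blast
    moreover have "s = t" if "s \<in> T" "c \<in> cells s" for s
      using disjoint_family_onD[OF disj, of s t] that \<open>t \<in> T\<close> \<open>c \<in> cells t\<close> by blast
    ultimately show ?thesis by (intro ex1I[of _ t]) blast+
  qed
  moreover have "\<forall>t\<in>T. cells t \<subseteq> board n"
    using cover by blast
  ultimately show "is_tiling n T"
    unfolding is_tiling_def by (intro conjI ballI) simp_all
qed

lemma tiles_region_Un:
  assumes "tiles_region S T" "tiles_region S' B" "S \<inter> S' = {}"
  shows "tiles_region (S \<union> S') (T \<union> B)"
  unfolding tiles_region_def
proof
  show "\<Union> (cells ` (T \<union> B)) = S \<union> S'"
    using assms(1,2) by (simp add: tiles_region_def image_Un)
  have TB: "cells t \<inter> cells b = {}" if "t \<in> T" "b \<in> B" for t b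
  proof -
    have "cells t \<subseteq> S" "cells b \<subseteq> S'"
      using assms(1,2) that by (auto simp: tiles_region_def)
    with assms(3) show ?thesis by blast
  qed
  show "disjoint_family_on cells (T \<union> B)"
    unfolding disjoint_family_on_def
  proof (intro ballI impI)
    fix s t assume "s \<in> T \<union> B" "t \<in> T \<union> B" "s \<noteq> t"
    moreover have "disjoint_family_on cells T" "disjoint_family_on cells B"
      using assms(1,2) by (auto simp: tiles_region_def)
    ultimately show "cells s \<inter> cells t = {}"
      using TB[of s t] TB[of t s] by (auto dest: disjoint_family_onD)
  qed
qed

text \<open>\<open>B\<close> already uses up \<open>S'\<close>, so by disjointness the other tiles
  of \<open>T\<close> avoid \<open>S'\<close>. Together with \<open>B\<close> they cover
  \<open>S \<union> S'\<close>, hence they cover exactly \<open>S\<close>.\<close>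

lemma tiles_region_Diff:
  assumes "tiles_region (S \<union> S') T" "tiles_region S' B" "B \<subseteq> T" "S \<inter> S' = {}"
  shows "tiles_region S (T - B)"
  unfolding tiles_region_def
proof
  have T: "\<Union> (cells ` T) = S \<union> S'" "disjoint_family_on cells T" and B: "\<Union> (cells ` B) = S'"
    using assms(1,2) by (auto simp: tiles_region_def)
  show "disjoint_family_on cells (T - B)"
    using T(2) by (rule disjoint_family_on_mono[rotated]) auto
  have "cells t \<inter> cells b = {}" if "t \<in> T - B" "b \<in> B" for t b
    using disjoint_family_onD[OF T(2), of t b] that \<open>B \<subseteq> T\<close> by auto
  with B have "\<Union> (cells ` (T - B)) \<inter> S' = {}"
    by blast
  moreover have "\<Union> (cells ` (T - B)) \<union> S' = \<Union> (cells ` ((T - B) \<union> B))"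
    by (simp only: image_Un Union_Un_distrib B)
  then have "\<Union> (cells ` (T - B)) \<union> S' = S \<union> S'"
    using T(1) \<open>B \<subseteq> T\<close> by (simp add: Un_absorb2)
  ultimately show "\<Union> (cells ` (T - B)) = S"
    using \<open>S \<inter> S' = {}\<close> by blast
qed

text \<open>A common tile would have all its cells in the empty set \<open>S \<inter> S'\<close>,
  but every tile has a cell.\<close>

lemma tiles_region_disjoint:
  assumes "tiles_region S T" "tiles_region S' B" "S \<inter> S' = {}"
  shows "T \<inter> B = {}"
proof -
  have "cells t \<subseteq> S \<inter> S'" if "t \<in> T \<inter> B" for t
    using assms(1,2) that by (auto simp: tiles_region_def)
  with assms(3) cells_nonempty show ?thesis by fastforce
qed

text \<open>Adding \<open>B\<close> and removing \<open>B\<close> are mutually inverse; the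
  disjointness of \<open>T\<close> and \<open>B\<close> ensures that removal gives back
  \<open>T\<close>.\<close>

lemma card_tiles_region_superset:
  assumes B: "tiles_region S' B" and S: "S \<inter> S' = {}"
  shows "card {T. tiles_region (S \<union> S') T \<and> B \<subseteq> T} = card {T. tiles_region S T}"
proof (rule sym, rule bij_betw_same_card, rule bij_betw_byWitness[where f' = "\<lambda>T. T - B"])
  show "\<forall>T\<in>{T. tiles_region S T}. (T \<union> B) - B = T"
    using tiles_region_disjoint[OF _ B S] by blast
  show "\<forall>T\<in>{T. tiles_region (S \<union> S') T \<and> B \<subseteq> T}. (T - B) \<union> B = T"
    by blast
  show "(\<lambda>T. T \<union> B) ` {T. tiles_region S T} \<subseteq> {T. tiles_region (S \<union> S') T \<and> B \<subseteq> T}"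
    using tiles_region_Un[OF _ B S] by blast
  show "(\<lambda>T. T - B) ` {T. tiles_region (S \<union> S') T \<and> B \<subseteq> T} \<subseteq> {T. tiles_region S T}"
    using tiles_region_Diff[OF _ B _ S] by blast
qed

text \<open>The counting principle for blocks: once the tiles on the last \<open>n - m\<close> cells
  are fixed, what remains to be tiled is an initial board.\<close>

lemma card_tilings_ending_with:
  assumes "tiles_region {m<..n} B" "m \<le> n"
  shows "card {T. is_tiling n T \<and> B \<subseteq> T} = card {T. is_tiling m T}"
proof -
  have "board n = board m \<union> {m<..n}" "board m \<inter> {m<..n} = {}"
    using \<open>m \<le> n\<close> by (auto simp: board_def)
  with card_tiles_region_superset[OF assms(1)] show ?thesis
    by (simp add: is_tiling_iff_tiles_region)
qed

lemma is_tiling_cover: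
  assumes "is_tiling n T" "1 \<le> c" "c \<le> n"
  obtains t where "t \<in> T" "c \<in> cells t" "cells t \<subseteq> {1..n}"
  using assms unfolding is_tiling_def board_def by (metis atLeastAtMost_iff)

lemma tiling_ending:
  assumes T: "is_tiling n T" and "n > 0"
  shows "{Square n} \<subseteq> T \<or>
    n \<ge> 3 \<and> {Fence (n - 2), Square (n - 1)} \<subseteq> T \<or>
    n \<ge> 4 \<and> {Fence (n - 2), Fence (n - 3)} \<subseteq> T"
proof -
  obtain t where t: "t \<in> T" "n \<in> cells t" "cells t \<subseteq> {1..n}"
    using is_tiling_cover[OF T, of n] \<open>n > 0\<close> by auto
  show ?thesis
  proof (cases t)
    case (Square i)
    with t show ?thesis by auto
  next
    case (Fence i)
    \<comment> \<open>A left post on cell \<open>n\<close> would put the right post off the board,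
      so \<open>n\<close> carries the right post; the left post on \<open>n - 2\<close> forces
      \<open>n \<ge> 3\<close>.\<close>
    with t have i: "i = n - 2" "n \<ge> 3" by auto
    then have "1 \<le> n - 1" "n - 1 \<le> n" by auto
    then obtain s where s: "s \<in> T" "n - 1 \<in> cells s" "cells s \<subseteq> {1..n}"
      using is_tiling_cover[OF T] by blast
    show ?thesis
    proof (cases s)
      case (Square j)
      with s t i Fence show ?thesis by auto
    next
      case [simp]: (Fence j)
      \<comment> \<open>The same argument at the gap cell \<open>n - 1\<close>: a left post there
        would need cell \<open>n + 1\<close>.\<close>
      from s have "j = n - 3" "n \<ge> 4" by auto
      with s t i \<open>t = Fence i\<close> show ?thesis by auto
    qed
  qed
qed

text \<open>The guards matter because subtraction on naturals truncates: for \<open>n < 3\<close>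
  the term for \<open>n - 3\<close> would wrongly count the empty tiling of the 0-board.\<close>

lemma card_tilings_rec:
  assumes "n > 0"
  shows "card {T. is_tiling n T} = card {T. is_tiling (n - 1) T}
    + (if n \<ge> 3 then card {T. is_tiling (n - 3) T} else 0)
    + (if n \<ge> 4 then card {T. is_tiling (n - 4) T} else 0)"
proof -
  define X where "X B = {T. is_tiling n T \<and> B \<subseteq> T}" for B
  let ?S = "{Square n}"
  let ?FS = "{Fence (n - 2), Square (n - 1)}"
  let ?FF = "{Fence (n - 2), Fence (n - 3)}"
  let ?Y = "if n \<ge> 3 then X ?FS else {}"
  let ?Z = "if n \<ge> 4 then X ?FF else {}"
  have fin: "finite (X B)" for B
    by (rule finite_subset[OF _ finite_tilings[of n]]) (auto simp: X_def)
  have split: "{T. is_tiling n T} = X ?S \<union> (?Y \<union> ?Z)"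
    using tiling_ending[OF _ \<open>n > 0\<close>] by (auto simp: X_def)
  \<comment> \<open>Two different tiles sharing a cell cannot occur in one tiling, so a single
    conflicting cell separates two blocks.\<close>
  have disjI: "X B \<inter> X B' = {}" if "b \<in> B" "b' \<in> B'" "c \<in> cells b" "c \<in> cells b'" "b \<noteq> b'"
    for b b' c B B'
    using that is_tiling_unique[of n _ b b' c] by (auto simp: X_def)
  \<comment> \<open>The conflict is at cell \<open>n\<close>: a square against a right post.\<close>
  have "X ?S \<inter> X ?FS = {}" "X ?S \<inter> X ?FF = {}" if "n \<ge> 3"
    using that by (intro disjI[of "Square n" _ "Fence (n - 2)" _ n]; auto)+
  \<comment> \<open>Both blocks contain the same last fence, so they conflict only in how its gap
    cell \<open>n - 1\<close> is filled.\<close>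
  moreover have "X ?FS \<inter> X ?FF = {}" if "n \<ge> 4"
    using that by (intro disjI[of "Square (n - 1)" _ "Fence (n - 3)" _ "n - 1"]) auto
  ultimately have disj: "X ?S \<inter> (?Y \<union> ?Z) = {}" "?Y \<inter> ?Z = {}"
    by auto
  have card_X: "card (X B) = card {T. is_tiling m T}" if "tiles_region {m<..n} B" "m \<le> n" for m B
    unfolding X_def by (rule card_tilings_ending_with[OF that])
  \<comment> \<open>The three blocks fill exactly the last one, three and four cells.\<close>
  have "card (X ?S) = card {T. is_tiling (n - 1) T}"
    using \<open>n > 0\<close> by (intro card_X) (auto simp: tiles_region_def disjoint_family_on_def)
  moreover have "card (X ?FS) = card {T. is_tiling (n - 3) T}" if "n \<ge> 3"
    using that by (intro card_X) (auto simp: tiles_region_def disjoint_family_on_def)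
  moreover have "card (X ?FF) = card {T. is_tiling (n - 4) T}" if "n \<ge> 4"
    using that by (intro card_X) (auto simp: tiles_region_def disjoint_family_on_def)
  moreover have "card {T. is_tiling n T} = card (X ?S) + (card ?Y + card ?Z)"
    unfolding split using fin disj by (subst card_Un_disjoint; simp add: card_Un_disjoint)
  ultimately show ?thesis by simp
qed

theorem theorem2p1:
  fixes n :: int
  assumes "n \<ge> 0"
  shows "A n = (if n = 0 then 1 else 0) + A (n - 1) + A (n - 3) + A (n - 4)"
proof (cases "n = 0")
  case True
  \<comment> \<open>All shifted arguments are negative, where \<open>A\<close> is 0 by
    definition.\<close>
  then show ?thesis using A_0 by (simp add: A_def)
next
  case False
  with assms have "nat n > 0" by simp
  \<comment> \<open>The guards \<open>n \<ge> 3\<close> and \<open>n \<ge> 4\<close> match the value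
    0 of \<open>A\<close> at negative arguments.\<close>
  from card_tilings_rec[OF this] False assms show ?thesis
    by (auto simp: A_def nat_diff_distrib)
qed

end
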